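(* Let $s,t$ be positive integers with $\min\{s,t\}\ge 2$, and let $M$ be an $(s,t)$-spike of order $m\ge\max\{3s+t,\,s+3t\}-4$. Then $M$ is $(2\min\{s,t\}-1)$-connected.
   Context: For positive integers $s,t$, an $(s,t)$-spike of order $m$ is a matroid $M$ with $m\ge\max\{s,t\}$ together with a partition $(A_1,\dots,A_m)$ of $E(M)$ into $2$-element sets (the arms) such that the union of any $s$ of the $A_i$ is a circuit of $M$ and the union of any $t$ of the $A_i$ is a cocircuit of $M$. The connectivity function of $M$ is $\lambda(X)=r(X)+r(E(M)-X)-r(M)$ for $X\subseteq E(M)$. For a positive integer $k$, a $k$-separation of $M$ is a partition $(X,Y)$ of $E(M)$ with $|X|,|Y|\ge k$ and $\lambda(X)<k$; $M$ is $n$-connected if it has no $k$-separation for any $k<n$. *)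

theory Defs
  imports Main "HOL-Library.Disjoint_Sets"
begin

locale matroid =
  fixes E :: "'a set" and indep :: "'a set \<Rightarrow> bool"
  assumes finite_ground: "finite E"
    and indep_subset_ground: "indep X \<Longrightarrow> X \<subseteq> E"
    and indep_empty: "indep {}"
    and indep_subset: "indep X \<Longrightarrow> Y \<subseteq> X \<Longrightarrow> indep Y"
    and augmentation:
      "indep X \<Longrightarrow> indep Y \<Longrightarrow> card X < card Y \<Longrightarrow> \<exists>e \<in> Y - X. indep (insert e X)"
begin

definition basis :: "'a set \<Rightarrow> bool" where
  "basis B \<longleftrightarrow> indep B \<and> (\<forall>X. indep X \<and> B \<subseteq> X \<longrightarrow> X = B)"

definition circuit :: "'a set \<Rightarrow> bool" where
  "circuit C \<longleftrightarrow> C \<subseteq> E \<and> \<not> indep C \<and> (\<forall>X. X \<subset> C \<longrightarrow> indep X)"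

(* The bases of the dual matroid are the complements of the bases. *)
definition dual_indep :: "'a set \<Rightarrow> bool" where
  "dual_indep X \<longleftrightarrow> (\<exists>B. basis B \<and> X \<subseteq> E - B)"

definition cocircuit :: "'a set \<Rightarrow> bool" where
  "cocircuit C \<longleftrightarrow> matroid.circuit E dual_indep C"

definition rank :: "'a set \<Rightarrow> nat" where
  "rank X = Max {card I | I. I \<subseteq> X \<and> indep I}"

definition connectivity :: "'a set \<Rightarrow> int" where
  "connectivity X = int (rank X) + int (rank (E - X)) - int (rank E)"

definition k_separation :: "nat \<Rightarrow> 'a set \<Rightarrow> 'a set \<Rightarrow> bool" where
  "k_separation k X Y \<longleftrightarrow>
     0 < k \<and> X \<union> Y = E \<and> X \<inter> Y = {} \<and> k \<le> card X \<and> k \<le> card Y \<and> connectivity X < int k"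

definition n_connected :: "nat \<Rightarrow> bool" where
  "n_connected n \<longleftrightarrow> (\<forall>k<n. \<not> (\<exists>X Y. k_separation k X Y))"

end

locale st_spike = matroid E indep
  for E :: "'a set" and indep :: "'a set \<Rightarrow> bool" +
  fixes s t m :: nat and A :: "nat \<Rightarrow> 'a set"
  assumes s_pos: "0 < s" and t_pos: "0 < t"
    and order_ge: "max s t \<le> m"
    and arms_disjoint: "disjoint_family_on A {1..m}"
    and arms_cover: "(\<Union>i\<in>{1..m}. A i) = E"
    and arms_card: "\<And>i. i \<in> {1..m} \<Longrightarrow> card (A i) = 2"
    and arms_circuit: "\<And>I. I \<subseteq> {1..m} \<Longrightarrow> card I = s \<Longrightarrow> circuit (\<Union>i\<in>I. A i)"
    and arms_cocircuit: "\<And>I. I \<subseteq> {1..m} \<Longrightarrow> card I = t \<Longrightarrow> cocircuit (\<Union>i\<in>I. A i)"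

end

theory Submission
  imports Defs
begin

text \<open>
  By duality assume \<open>s \<le> t\<close>. A set containing \<open>s - 1\<close> arms spans every further arm that it
  meets, and a set of at least \<open>m - t + 1\<close> arms is spanning; together with the dual statements this
  determines the rank of every union of arms, and \<open>r(M) = m + s - t\<close>. For a partition \<open>(X, Y)\<close> of
  the ground set, compare the numbers of arms contained in \<open>X\<close> and in \<open>Y\<close> with \<open>s - 1\<close> and
  \<open>t - 1\<close>. If \<open>X\<close> contains few arms, completing it to contain \<open>s - 1\<close> of the arms it meets costs
  little rank, which bounds \<open>r(X)\<close> from below.
\<close>

section \<open>Matroid rank and duality\<close>

context matroid
begin

lemma indep_finite: "indep I \<Longrightarrow> finite I"
  using finite_ground finite_subset indep_subset_ground by blast

lemma card_compl: "X \<subseteq> E \<Longrightarrow> card (E - X) + card X = card E"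
  using card_Int_Diff[OF finite_ground, of X] by (simp add: Int_absorb1)

lemma finite_indep_cards: "finite {card I | I. I \<subseteq> X \<and> indep I}"
proof (rule finite_subset)
  show "{card I | I. I \<subseteq> X \<and> indep I} \<subseteq> {..card E}"
    using card_mono[OF finite_ground] indep_subset_ground by auto
qed simp

lemma card_le_rank: "I \<subseteq> X \<Longrightarrow> indep I \<Longrightarrow> card I \<le> rank X"
  unfolding rank_def by (rule Max_ge[OF finite_indep_cards]) auto

lemma obtain_rank_set:
  obtains I where "I \<subseteq> X" "indep I" "card I = rank X"
proof -
  have "{card I | I. I \<subseteq> X \<and> indep I} \<noteq> {}"
    using indep_empty by auto
  from Max_in[OF finite_indep_cards this] that show thesis
    unfolding rank_def by auto
qed

lemma rank_mono: "X \<subseteq> Y \<Longrightarrow> rank X \<le> rank Y"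
  by (metis obtain_rank_set card_le_rank order_trans)

lemma rank_le_card: "finite X \<Longrightarrow> rank X \<le> card X"
  by (metis obtain_rank_set card_mono)

lemma rank_indep: "indep X \<Longrightarrow> rank X = card X"
  using rank_le_card card_le_rank indep_finite by (metis order_antisym order_refl)

lemma indep_iff_rank:
  assumes "finite X"
  shows "indep X \<longleftrightarrow> rank X = card X"
  using assms by (metis rank_indep obtain_rank_set card_subset_eq)

text \<open>Augmenting from an independent subset of \<open>X\<close> of size \<open>rank X\<close>
  never leaves \<open>X\<close>, so any smaller independent subset can be grown one element at a
  time.\<close>

lemma indep_extend:
  assumes "indep I" "I \<subseteq> X"
  obtains J where "I \<subseteq> J" "J \<subseteq> X" "indep J" "card J = rank X"
proof -
  have "\<exists>J. I \<subseteq> J \<and> J \<subseteq> X \<and> indep J \<and> card J = rank X"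
    using assms
  proof (induction "rank X - card I" arbitrary: I rule: less_induct)
    case less
    show ?case
    proof (cases "card I < rank X")
      case True
      obtain K where K: "K \<subseteq> X" "indep K" "card K = rank X"
        by (rule obtain_rank_set)
      with True less.prems obtain e where e: "e \<in> K - I" "indep (insert e I)"
        using augmentation by metis
      have "card (insert e I) = Suc (card I)"
        using e indep_finite[OF less.prems(1)] by simp
      with less.hyps[of "insert e I"] True e K less.prems show ?thesis
        by (metis Diff_iff Suc_diff_Suc insert_subset lessI subsetD)
    next
      case False
      with less.prems card_le_rank[of I X] show ?thesis
        by (metis linorder_neqE_nat not_le order_refl)
    qed
  qed
  with that show thesis by blast
qed

text \<open>A maximum independent subset \<open>I\<close> of the intersection extends to a maximum
  one \<open>J\<close> of the union. The traces of \<open>J\<close> on \<open>X\<close> and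
  \<open>Y\<close> are independent, and they overlap in at least \<open>I\<close>.\<close>

lemma rank_submodular: "rank (X \<union> Y) + rank (X \<inter> Y) \<le> rank X + rank Y"
proof -
  obtain I where I: "I \<subseteq> X \<inter> Y" "indep I" "card I = rank (X \<inter> Y)"
    by (rule obtain_rank_set)
  obtain J where J: "I \<subseteq> J" "J \<subseteq> X \<union> Y" "indep J" "card J = rank (X \<union> Y)"
    using indep_extend[OF I(2), of "X \<union> Y"] I by blast
  have fin: "finite J" using J indep_finite by blast
  have "card J + card (J \<inter> X \<inter> Y) = card (J \<inter> X) + card (J \<inter> Y)"
    using card_Un_Int[of "J \<inter> X" "J \<inter> Y"] fin J(2)
    by (metis Int_Un_distrib Int_absorb2 Int_assoc Int_left_commute finite_Int inf.idem)
  moreover have "card I \<le> card (J \<inter> X \<inter> Y)"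
    using fin I J by (intro card_mono) auto
  moreover have "card (J \<inter> X) \<le> rank X" "card (J \<inter> Y) \<le> rank Y"
    by (meson Int_lower1 Int_lower2 J(3) card_le_rank indep_subset)+
  ultimately show ?thesis using I J by linarith
qed

lemma rank_Un_le: "finite Z \<Longrightarrow> rank (X \<union> Z) \<le> rank X + card Z"
  using rank_submodular[of X Z] rank_le_card[of Z] by linarith

text \<open>Submodularity for \<open>X\<close> and \<open>C\<close>: if \<open>e\<close> lies
  outside \<open>X\<close>, these meet in \<open>C - {e}\<close>, which already has the rank of
  \<open>C\<close>, so passing from \<open>X\<close> to the union gains nothing.\<close>

lemma rank_insert_circuit:
  assumes "circuit C" "e \<in> C" "C - {e} \<subseteq> X"
  shows "rank (insert e X) = rank X"
proof (cases "e \<in> X")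
  case False
  have fin: "finite C"
    using assms(1) finite_ground finite_subset unfolding circuit_def by blast
  have "rank C < card C"
    using assms(1) fin indep_iff_rank[OF fin] rank_le_card[OF fin] unfolding circuit_def by simp
  moreover have "rank (C - {e}) = card C - 1"
  proof -
    have "indep (C - {e})" using assms(1,2) unfolding circuit_def by blast
    then show ?thesis using rank_indep assms(2) fin by simp
  qed
  moreover have "X \<union> C = insert e X" "X \<inter> C = C - {e}" using assms(2,3) False by auto
  ultimately have "rank (insert e X) \<le> rank X"
    using rank_submodular[of X C] by simp
  then show ?thesis using rank_mono[of X "insert e X"] by (simp add: subset_insertI le_antisym)
qed (simp add: insert_absorb)

section \<open>Bases, the dual matroid and its rank function\<close>

lemma basis_iff: "basis B \<longleftrightarrow> indep B \<and> card B = rank E"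
proof
  assume B: "basis B"
  then have "indep B" unfolding basis_def by simp
  moreover from this obtain J where "B \<subseteq> J" "indep J" "card J = rank E"
    using indep_extend indep_subset_ground by metis
  ultimately show "indep B \<and> card B = rank E" using B unfolding basis_def by metis
next
  assume B: "indep B \<and> card B = rank E"
  show "basis B" unfolding basis_def
  proof (intro conjI allI impI)
    fix X assume X: "indep X \<and> B \<subseteq> X"
    then have "card X \<le> card B" using B card_le_rank indep_subset_ground by simp
    then show "X = B" using X card_seteq indep_finite by metis
  qed (use B in simp)
qed

text \<open>A set avoids some basis exactly when its complement is spanning.\<close>

lemma dual_indep_iff: "dual_indep X \<longleftrightarrow> X \<subseteq> E \<and> rank (E - X) = rank E"
proof
  assume "dual_indep X"
  then obtain B where B: "basis B" "X \<subseteq> E - B" unfolding dual_indep_def by blast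
  then have "rank E \<le> rank (E - X)"
    using card_le_rank[of B "E - X"] indep_subset_ground basis_iff by auto
  then show "X \<subseteq> E \<and> rank (E - X) = rank E" using B rank_mono[of "E - X" E] by auto
next
  assume X: "X \<subseteq> E \<and> rank (E - X) = rank E"
  obtain B where "B \<subseteq> E - X" "indep B" "card B = rank (E - X)" by (rule obtain_rank_set)
  then show "dual_indep X" unfolding dual_indep_def basis_iff using X by auto
qed

lemma matroid_dual: "matroid E dual_indep"
proof
  show "finite E" by (rule finite_ground)
  show "\<And>X. dual_indep X \<Longrightarrow> X \<subseteq> E" by (simp add: dual_indep_iff)
  show "dual_indep {}" by (simp add: dual_indep_iff)
  show "\<And>X Y. dual_indep X \<Longrightarrow> Y \<subseteq> X \<Longrightarrow> dual_indep Y"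
    unfolding dual_indep_def by blast
next
  fix X Y
  assume X: "dual_indep X" and Y: "dual_indep Y" and less: "card X < card Y"
  obtain B where B: "indep B" "card B = rank E" "Y \<subseteq> E - B"
    using Y unfolding dual_indep_def basis_iff by blast
  have finX: "finite X" and finY: "finite Y"
    using X Y finite_ground finite_subset by (auto simp: dual_indep_iff)
  have finB: "finite B" using B indep_finite by blast
  \<comment> \<open>\<open>B\<close> avoids \<open>Y\<close>. Keeping what survives of
    \<open>B\<close> outside \<open>X\<close> and completing it within the spanning set
    \<open>E - X\<close> gives a basis \<open>B'\<close> avoiding \<open>X\<close>; any element of
    \<open>Y - X\<close> outside \<open>B'\<close> can then be added to \<open>X\<close>.\<close>
  have "indep (B - X)" "B - X \<subseteq> E - X"
    using B(1) indep_subset indep_subset_ground by blast+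
  then obtain B' where B': "B - X \<subseteq> B'" "B' \<subseteq> E - X" "indep B'" "card B' = rank (E - X)"
    by (rule indep_extend)
  have bas: "basis B'" using B' X by (simp add: basis_iff dual_indep_iff)
  show "\<exists>e\<in>Y - X. dual_indep (insert e X)"
  proof (cases "Y - X \<subseteq> B'")
    case True
    \<comment> \<open>If \<open>B'\<close> contained all of \<open>Y - X\<close> next to
      \<open>B - X\<close>, counting would force
      \<open>card (Y - X) \<le> card (B \<inter> X) \<le> card (X - Y)\<close>, against
      \<open>card X < card Y\<close>.\<close>
    have "card (B - X) + card (Y - X) = card ((B - X) \<union> (Y - X))"
      using B(3) finB finY by (intro card_Un_disjoint[symmetric]) auto
    also have "\<dots> \<le> card B'"
      using True B' indep_finite by (intro card_mono) auto
    also have "\<dots> = card B" using B B' X by (simp add: dual_indep_iff)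
    finally have 1: "card (B - X) + card (Y - X) \<le> card B" .
    have 2: "card B = card (B - X) + card (B \<inter> X)"
      by (metis Diff_Int2 Int_commute add.commute card_Int_Diff finB)
    have 3: "card (B \<inter> X) \<le> card (X - Y)"
      using B(3) finX by (intro card_mono) auto
    have "card (X - Y) < card (Y - X)"
      using less card_Int_Diff[OF finX, of Y] card_Int_Diff[OF finY, of X]
      by (simp add: Int_commute)
    with 1 2 3 have False by linarith
    then show ?thesis ..
  next
    case False
    then obtain e where "e \<in> Y - X" "e \<notin> B'" by blast
    moreover have "dual_indep (insert e X)"
      unfolding dual_indep_def using bas B' X Y calculation by (auto simp: dual_indep_iff)
    ultimately show ?thesis by blast
  qed
qed

abbreviation dual_rank :: "'a set \<Rightarrow> nat" where
  "dual_rank \<equiv> matroid.rank dual_indep"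

text \<open>The usual formula for the corank, with \<open>rank E\<close> moved to the left to avoid
  subtraction on naturals. For one inequality a basis avoids a largest coindependent subset of
  \<open>X\<close>; for the other, a maximum independent subset of \<open>E - X\<close> is extended
  to a basis \<open>B\<close>, and \<open>X - B\<close> is coindependent.\<close>

lemma dual_rank_eq:
  assumes "X \<subseteq> E"
  shows "dual_rank X + rank E = card X + rank (E - X)"
proof (rule order_antisym)
  interpret dual: matroid E dual_indep by (rule matroid_dual)
  have finX: "finite X" using assms finite_ground finite_subset by blast
  show "dual_rank X + rank E \<le> card X + rank (E - X)"
  proof -
    obtain I where I: "I \<subseteq> X" "dual_indep I" "card I = dual_rank X"
      by (rule dual.obtain_rank_set)
    obtain B where B: "indep B" "card B = rank E" "I \<subseteq> E - B"
      using I(2) unfolding dual_indep_def basis_iff by blast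
    have finB: "finite B" using B indep_finite by blast
    have "card I + card (B \<inter> X) = card (I \<union> (B \<inter> X))"
      using B(3) finB finX I(1) finite_subset by (intro card_Un_disjoint[symmetric]) auto
    also have "\<dots> \<le> card X" using finX I(1) by (intro card_mono) auto
    finally have "card I + card (B \<inter> X) \<le> card X" .
    moreover have "card (B - X) \<le> rank (E - X)"
      using B(1) indep_subset indep_subset_ground by (intro card_le_rank) blast+
    moreover have "card B = card (B \<inter> X) + card (B - X)"
      by (rule card_Int_Diff[OF finB])
    ultimately show ?thesis using I B by linarith
  qed
  show "card X + rank (E - X) \<le> dual_rank X + rank E"
  proof -
    obtain J where J: "J \<subseteq> E - X" "indep J" "card J = rank (E - X)"
      by (rule obtain_rank_set)
    obtain B where B: "J \<subseteq> B" "B \<subseteq> E" "indep B" "card B = rank E"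
      using indep_extend[OF J(2), of E] J by blast
    have finB: "finite B" using B indep_finite by blast
    have "dual_indep (X - B)"
      unfolding dual_indep_def basis_iff using B assms by blast
    then have "card (X - B) \<le> dual_rank X" by (intro dual.card_le_rank) auto
    moreover have "card J \<le> card (B - X)" using J B finB by (intro card_mono) auto
    ultimately show ?thesis
      using J B card_Int_Diff[OF finB, of X] card_Int_Diff[OF finX, of B]
      by (simp add: Int_commute)
  qed
qed

text \<open>By the corank formula, \<open>E - X\<close> has full dual rank exactly when
  \<open>rank X = card X\<close>.\<close>

lemma dual_dual_indep: "matroid.dual_indep E dual_indep = indep"
proof
  fix X
  interpret dual: matroid E dual_indep by (rule matroid_dual)
  show "dual.dual_indep X = indep X"
  proof (cases "X \<subseteq> E")
    case True
    then have "card (E - X) + card X = card E" "finite X"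
      using card_compl finite_ground finite_subset by blast+
    then show ?thesis
      using True dual_rank_eq[of "E - X"] dual_rank_eq[of E]
      by (auto simp: dual.dual_indep_iff indep_iff_rank double_diff rank_indep[OF indep_empty])
  next
    case False
    then show ?thesis using indep_subset_ground dual.dual_indep_iff by blast
  qed
qed

lemma connectivity_dual:
  assumes "X \<subseteq> E"
  shows "matroid.connectivity E dual_indep X = connectivity X"
proof -
  interpret dual: matroid E dual_indep by (rule matroid_dual)
  show ?thesis
    using assms card_compl[OF assms] dual_rank_eq[of X] dual_rank_eq[of "E - X"] dual_rank_eq[of E]
    by (simp add: dual.connectivity_def connectivity_def double_diff rank_indep[OF indep_empty])
qed

lemma connectivity_compl: "X \<subseteq> E \<Longrightarrow> connectivity (E - X) = connectivity X"
  by (simp add: connectivity_def double_diff)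

end

section \<open>Ranks in spikes\<close>

context st_spike
begin

definition arms :: "nat set \<Rightarrow> 'a set" where
  "arms J = (\<Union>i\<in>J. A i)"

definition inside :: "'a set \<Rightarrow> nat set" where
  "inside X = {i \<in> {1..m}. A i \<subseteq> X}"

definition meeting :: "'a set \<Rightarrow> nat set" where
  "meeting X = {i \<in> {1..m}. A i \<inter> X \<noteq> {}}"

text \<open>Lets every later result be applied to the dual with \<open>s\<close> and
  \<open>t\<close> exchanged. The cocircuit condition of the dual is the circuit condition of the
  original because the double dual is the matroid itself.\<close>

lemma dual_spike: "st_spike E dual_indep t s m A"
proof -
  interpret dual: matroid E dual_indep by (rule matroid_dual)
  show ?thesis
  proof
    show "max t s \<le> m" using order_ge by simp
    show "\<And>I. I \<subseteq> {1..m} \<Longrightarrow> card I = t \<Longrightarrow> dual.circuit (\<Union> (A ` I))"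
      using arms_cocircuit unfolding cocircuit_def .
    show "\<And>I. I \<subseteq> {1..m} \<Longrightarrow> card I = s \<Longrightarrow> dual.cocircuit (\<Union> (A ` I))"
      unfolding dual.cocircuit_def dual_dual_indep by (rule arms_circuit)
  qed (use s_pos t_pos arms_disjoint arms_cover arms_card in auto)
qed

lemma t_le_order: "t \<le> m"
  using order_ge by simp

lemma arms_subset: "J \<subseteq> {1..m} \<Longrightarrow> arms J \<subseteq> E"
  using arms_cover unfolding arms_def by blast

lemma arms_all: "arms {1..m} = E"
  using arms_cover unfolding arms_def .

lemma arms_Un: "arms (I \<union> J) = arms I \<union> arms J"
  unfolding arms_def by blast

lemma finite_arms: "J \<subseteq> {1..m} \<Longrightarrow> finite (arms J)"
  using arms_subset finite_ground finite_subset by blast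

lemma card_arms:
  assumes "J \<subseteq> {1..m}"
  shows "card (arms J) = 2 * card J"
proof -
  have "card (\<Union>i\<in>J. A i) = (\<Sum>i\<in>J. card (A i))"
  proof (rule card_UN_disjoint)
    show "finite J" using assms finite_subset by blast
    show "\<forall>i\<in>J. finite (A i)" using assms arms_card by (metis card.infinite subsetD zero_neq_numeral)
    show "\<forall>i\<in>J. \<forall>j\<in>J. i \<noteq> j \<longrightarrow> A i \<inter> A j = {}"
      using assms arms_disjoint unfolding disjoint_family_on_def by blast
  qed
  also have "\<dots> = 2 * card J" using assms arms_card by (simp add: subset_iff)
  finally show ?thesis unfolding arms_def .
qed

lemma card_ground: "card E = 2 * m"
  using card_arms[OF order_refl] unfolding arms_all by simp

lemma arms_compl:
  assumes "J \<subseteq> {1..m}"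
  shows "E - arms J = arms ({1..m} - J)"
proof -
  have "arms J \<inter> arms ({1..m} - J) = {}"
    using assms arms_disjoint unfolding arms_def disjoint_family_on_def by fast
  moreover have "arms J \<union> arms ({1..m} - J) = E"
    using assms unfolding arms_Un[symmetric] by (simp add: Un_absorb1 arms_all[simplified])
  ultimately show ?thesis by blast
qed

text \<open>Such a union is a proper subset of a circuit formed by \<open>s\<close> arms.\<close>

lemma indep_arms:
  assumes "J \<subseteq> {1..m}" "card J < s"
  shows "indep (arms J)"
proof -
  obtain I where I: "J \<subseteq> I" "I \<subseteq> {1..m}" "card I = s"
    using exists_subset_between[of J s "{1..m}"] assms order_ge by auto
  have "arms J \<noteq> arms I"
    using card_arms[OF I(2)] card_arms[OF assms(1)] assms I(3) by auto
  then have "arms J \<subset> arms I" using I(1) unfolding arms_def by blast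
  then show ?thesis using arms_circuit[OF I(2,3)] unfolding circuit_def arms_def by blast
qed

text \<open>With \<open>s - 1\<close> arms inside \<open>X\<close>, the arm \<open>A i\<close>
  completes a circuit whose only element possibly outside \<open>X\<close> is the second element of
  \<open>A i\<close>.\<close>

lemma rank_Un_arm:
  assumes "S \<subseteq> {1..m}" "s - 1 \<le> card S" "arms S \<subseteq> X" "i \<in> {1..m}" "A i \<inter> X \<noteq> {}"
  shows "rank (X \<union> A i) = rank X"
proof (cases "A i \<subseteq> X")
  case False
  then have "i \<notin> S" using assms(3) unfolding arms_def by blast
  obtain a b where ab: "A i = {a, b}" "a \<in> X" "b \<notin> X"
  proof -
    obtain a b where "A i = {a, b}" using arms_card[OF assms(4)] unfolding card_2_iff by blast
    then show thesis using that[of a b] that[of b a] assms(5) False by auto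
  qed
  obtain S' where S': "S' \<subseteq> S" "card S' = s - 1" "finite S'"
    using assms(2) by (rule obtain_subset_with_card_n)
  have "card (insert i S') = s" using S' \<open>i \<notin> S\<close> s_pos by (auto simp: card_insert_if)
  then have "circuit (arms (insert i S'))"
    unfolding arms_def using S' assms by (intro arms_circuit) auto
  then have "rank (insert b X) = rank X"
    by (rule rank_insert_circuit) (use ab S' assms(3) in \<open>auto simp: arms_def\<close>)
  moreover have "X \<union> A i = insert b X" using ab by auto
  ultimately show ?thesis by simp
qed (simp add: Un_absorb2)

lemma rank_Un_arms:
  assumes "S \<subseteq> {1..m}" "s - 1 \<le> card S" "arms S \<subseteq> X" "J \<subseteq> meeting X"
  shows "rank (X \<union> arms J) = rank X"
proof -
  have "finite J" using assms(4) finite_subset unfolding meeting_def by fastforce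
  then show ?thesis using assms(4)
  proof induction
    case (insert i J)
    have "rank ((X \<union> arms J) \<union> A i) = rank (X \<union> arms J)"
      using insert.prems assms(1-3) by (intro rank_Un_arm[of S]) (auto simp: meeting_def)
    moreover have "X \<union> arms (insert i J) = (X \<union> arms J) \<union> A i" unfolding arms_def by auto
    ultimately show ?case using insert by simp
  qed (simp add: arms_def)
qed

section \<open>Arms contained in a set and arms meeting it\<close>

lemma arms_meeting: "X \<subseteq> E \<Longrightarrow> X \<subseteq> arms (meeting X)"
  using arms_cover unfolding arms_def meeting_def by blast

lemma inside_subset: "inside X \<subseteq> {1..m}" and meeting_subset: "meeting X \<subseteq> {1..m}"
  unfolding inside_def meeting_def by auto

lemma arms_inside: "arms (inside X) \<subseteq> X"
  unfolding arms_def inside_def by blast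

lemma inside_subset_meeting: "inside X \<subseteq> meeting X"
proof
  fix i assume "i \<in> inside X"
  moreover from this have "A i \<noteq> {}" using arms_card[of i] unfolding inside_def by force
  ultimately show "i \<in> meeting X" unfolding inside_def meeting_def by blast
qed

lemma card_meeting: "card (meeting X) + card (inside (E - X)) = m"
proof -
  have "meeting X \<union> inside (E - X) = {1..m}" "meeting X \<inter> inside (E - X) = {}"
    using arms_cover unfolding meeting_def inside_def by blast+
  then show ?thesis
    by (metis card_Un_disjoint card_atLeastAtMost diff_Suc_1 finite_Un finite_atLeastAtMost)
qed

text \<open>\<open>X\<close> spans every arm it meets, and it lies in the union of these
  arms.\<close>

lemma rank_eq_arms_meeting:
  assumes "X \<subseteq> E" "s - 1 \<le> card (inside X)"
  shows "rank X = rank (arms (meeting X))"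
  using rank_Un_arms[OF inside_subset assms(2) arms_inside order_refl] arms_meeting[OF assms(1)]
  by (simp add: Un_absorb1)

section \<open>Ranks of unions of arms\<close>

text \<open>Each further arm costs at most one unit of rank: once one of its elements is added, the
  arms in \<open>I\<close> span the other.\<close>

lemma rank_arms_mono_le:
  assumes "I \<subseteq> J" "J \<subseteq> {1..m}" "s - 1 \<le> card I"
  shows "rank (arms J) \<le> rank (arms I) + (card J - card I)"
proof -
  define f where "f i = (SOME a. a \<in> A i)" for i
  have f: "f i \<in> A i" if "i \<in> {1..m}" for i
    using arms_card[OF that] unfolding f_def by (metis card.empty ex_in_conv someI zero_neq_numeral)
  have finJ: "finite J" using assms(2) finite_subset by blast
  let ?X = "arms I \<union> f ` (J - I)"
  have "J - I \<subseteq> meeting ?X" using f assms(2) unfolding meeting_def by blast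
  then have "rank (?X \<union> arms (J - I)) = rank ?X"
    using assms by (intro rank_Un_arms[of I]) auto
  moreover have "arms J \<subseteq> ?X \<union> arms (J - I)" unfolding arms_def by blast
  ultimately have "rank (arms J) \<le> rank ?X" by (metis rank_mono)
  also have "\<dots> \<le> rank (arms I) + card (f ` (J - I))" using finJ by (intro rank_Un_le) simp
  also have "card (f ` (J - I)) \<le> card (J - I)" using finJ by (intro card_image_le) simp
  also have "card (J - I) = card J - card I"
    using assms(1) finJ finite_subset by (intro card_Diff_subset) auto
  finally show ?thesis by simp
qed

lemma rank_arms_le:
  assumes "J \<subseteq> {1..m}" "s - 1 \<le> card J"
  shows "rank (arms J) \<le> s - 1 + card J"
proof -
  obtain I where I: "I \<subseteq> J" "card I = s - 1"
    using assms(2) obtain_subset_with_card_n by metis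
  then have "rank (arms I) \<le> 2 * (s - 1)"
    using rank_le_card[OF finite_arms[of I]] card_arms[of I] assms(1) by auto
  then show ?thesis using rank_arms_mono_le[OF I(1) assms(1)] I assms(2) by linarith
qed

text \<open>The complement consists of fewer than \<open>t\<close> arms, hence is coindependent by
  the dual of \<open>indep_arms\<close>.\<close>

lemma rank_arms_spanning:
  assumes "J \<subseteq> {1..m}" "m < card J + t"
  shows "rank (arms J) = rank E"
proof -
  interpret dual: st_spike E dual_indep t s m A by (rule dual_spike)
  have "card ({1..m} - J) = m - card J"
    using card_Diff_subset[OF finite_subset[OF assms(1)] assms(1)] by simp
  then have "dual_indep (arms ({1..m} - J))"
    using assms t_pos by (intro dual.indep_arms) auto
  then show ?thesis using arms_compl[of "{1..m} - J"] assms(1)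
    by (simp add: dual_indep_iff double_diff)
qed

text \<open>A union of \<open>m - t + 1\<close> arms is spanning, and its rank is at most
  \<open>s - 1 + (m - t + 1)\<close>.\<close>

lemma rank_ground_le:
  assumes "s + t \<le> m + 1"
  shows "rank E + t \<le> m + s"
proof -
  have "m - t + 1 \<le> card {1..m}" using t_pos t_le_order by simp
  then obtain J where J: "J \<subseteq> {1..m}" "card J = m - t + 1"
    by (rule obtain_subset_with_card_n)
  then have "m < card J + t" "s - 1 \<le> card J" using assms by linarith+
  then show ?thesis
    using rank_arms_spanning[OF J(1)] rank_arms_le[OF J(1)] J(2) s_pos t_le_order by simp
qed

text \<open>The upper bounds for the matroid and its dual add up to \<open>2 * m\<close>, which is
  also the sum of the two ranks, so both are attained.\<close>

lemma rank_ground: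
  assumes "s + t \<le> m + 1"
  shows "rank E + t = m + s"
proof -
  interpret dual: st_spike E dual_indep t s m A by (rule dual_spike)
  have "dual_rank E + s \<le> m + t" using dual.rank_ground_le assms by simp
  moreover have "dual_rank E + rank E = 2 * m"
    using dual_rank_eq[of E] rank_indep[OF indep_empty] card_ground by simp
  ultimately show ?thesis using rank_ground_le[OF assms] by linarith
qed

text \<open>Growing \<open>J\<close> to \<open>m - t + 1\<close> arms reaches full rank at a cost of
  at most one per arm; since \<open>rank E\<close> is known exactly, \<open>arms J\<close> cannot
  have smaller rank.\<close>

lemma rank_arms_ge:
  assumes "s + t \<le> m + 1" "J \<subseteq> {1..m}" "s - 1 \<le> card J" "card J + t \<le> m + 1"
  shows "s - 1 + card J \<le> rank (arms J)"
proof -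
  have "m - t + 1 \<le> card {1..m}" "card J \<le> m - t + 1"
    using assms(4) t_pos t_le_order by auto
  then obtain I where I: "J \<subseteq> I" "I \<subseteq> {1..m}" "card I = m - t + 1"
    using exists_subset_between[of J "m - t + 1" "{1..m}"] assms(2) by blast
  then have "rank (arms I) = rank E" using order_ge by (intro rank_arms_spanning) auto
  then show ?thesis
    using rank_arms_mono_le[OF I(1,2) assms(3)] rank_ground[OF assms(1)] I(3) assms(4) order_ge s_pos
    by simp
qed

section \<open>Lower bounds on the rank of an arbitrary set\<close>

text \<open>Completing \<open>s - 1 - card (inside X)\<close> partially covered arms costs one
  element each; afterwards \<open>s - 1\<close> full arms are present and span every arm met by
  \<open>X\<close>.\<close>

lemma rank_arms_meeting_le:
  assumes "X \<subseteq> E" "card (inside X) \<le> s - 1" "s - 1 \<le> card (meeting X)"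
  shows "rank (arms (meeting X)) + card (inside X) \<le> rank X + (s - 1)"
proof -
  obtain S where S: "inside X \<subseteq> S" "S \<subseteq> meeting X" "card S = s - 1"
    using exists_subset_between[OF assms(2,3) inside_subset_meeting] finite_subset[OF meeting_subset]
    by auto
  have Sm: "S \<subseteq> {1..m}" using S(2) meeting_subset by blast
  have "card (arms S - X) \<le> card (S - inside X)"
  proof -
    \<comment> \<open>Choosing \<open>S\<close> within \<open>meeting X\<close> ensures that
      \<open>X\<close> already holds an element of each two-element arm to be completed.\<close>
    have "card (A i - X) \<le> 1" if "i \<in> S" for i
    proof -
      have "A i \<inter> X \<noteq> {}" "card (A i) = 2"
        using that S(2) arms_card Sm unfolding meeting_def by auto
      moreover from this(2) have "finite (A i)" by (metis card.infinite zero_neq_numeral)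
      ultimately have "card (A i - X) < card (A i)" by (intro psubset_card_mono) auto
      then show ?thesis using \<open>card (A i) = 2\<close> by simp
    qed
    moreover have "arms S - X = (\<Union>i\<in>S - inside X. A i - X)"
      using arms_inside unfolding arms_def by blast
    moreover have fin: "finite (S - inside X)" using Sm finite_subset by blast
    ultimately show ?thesis
      using card_UN_le[OF fin, of "\<lambda>i. A i - X"] sum_mono[of "S - inside X" "\<lambda>i. card (A i - X)" "\<lambda>_. 1"]
      by simp
  qed
  also have "\<dots> = s - 1 - card (inside X)"
    using card_Diff_subset[OF finite_subset[OF inside_subset] S(1)] S(3) by simp
  finally have "card (arms S - X) \<le> s - 1 - card (inside X)" .
  then have "rank (X \<union> arms S) + card (inside X) \<le> rank X + (s - 1)"
    using rank_Un_le[of "arms S - X" X] finite_arms[OF Sm] assms(2) by simp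
  moreover have "rank ((X \<union> arms S) \<union> arms (meeting X)) = rank (X \<union> arms S)"
  proof (rule rank_Un_arms[OF Sm])
    show "meeting X \<subseteq> meeting (X \<union> arms S)" unfolding meeting_def by blast
  qed (use S(3) in simp_all)
  moreover have "rank (arms (meeting X)) \<le> rank ((X \<union> arms S) \<union> arms (meeting X))"
    by (intro rank_mono) auto
  ultimately show ?thesis by simp
qed

text \<open>Fewer than \<open>t\<close> arms avoid \<open>X\<close>, so those meeting
  \<open>X\<close> span the matroid; the cost of completing arms is then subtracted from
  \<open>rank E\<close>, which is \<open>m + s - t\<close>.\<close>

lemma rank_ge_few_inside:
  assumes "s + t \<le> m + 1" "X \<subseteq> E" "card (inside X) \<le> s - 1" "card (inside (E - X)) < t"
  shows "m + 1 + card (inside X) \<le> rank X + t"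
proof -
  have "rank (arms (meeting X)) = rank E"
    using card_meeting[of X] assms(4) by (intro rank_arms_spanning meeting_subset) linarith
  moreover have "s - 1 \<le> card (meeting X)"
    using card_meeting[of X] assms by linarith
  ultimately show ?thesis
    using rank_arms_meeting_le[OF assms(2,3)] rank_ground[OF assms(1)] s_pos by linarith
qed

lemma rank_eq_ground:
  assumes "X \<subseteq> E" "s - 1 \<le> card (inside X)" "card (inside (E - X)) < t"
  shows "rank X = rank E"
  unfolding rank_eq_arms_meeting[OF assms(1,2)]
  using card_meeting[of X] assms(3) by (intro rank_arms_spanning meeting_subset) linarith

lemma rank_ge_many_inside:
  assumes "s + t \<le> m + 1" "X \<subseteq> E" "s - 1 \<le> card (inside X)"
  shows "rank X = rank E \<or> s - 1 + m \<le> rank X + card (inside (E - X))"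
proof (cases "card (inside (E - X)) < t")
  case True
  then show ?thesis using rank_eq_ground assms by blast
next
  case False
  have "card (inside X) \<le> card (meeting X)"
    using finite_subset[OF meeting_subset] inside_subset_meeting by (intro card_mono) auto
  then show ?thesis
    using rank_arms_ge[OF assms(1) meeting_subset, of X] False card_meeting[of X] assms(3)
    unfolding rank_eq_arms_meeting[OF assms(2,3)] by linarith
qed

section \<open>Connectivity of spikes\<close>

text \<open>The term \<open>card X\<close> in the minimum accounts for sets that are both
  independent and coindependent, for which the connectivity equals the size; these arise in the case
  \<open>dual\<close>.\<close>

lemma connectivity_ge_ordered:
  assumes "2 \<le> s" "s \<le> t" "s + 3 * t \<le> m + 4" "X \<subseteq> E"
    and le: "card (inside X) \<le> card (inside (E - X))"
  shows "min (2 * int s - 2) (int (card X)) \<le> connectivity X"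
proof -
  let ?a = "card (inside X)" and ?b = "card (inside (E - X))"
  have m: "s + t \<le> m + 1" using assms by linarith
  have Y: "E - X \<subseteq> E" and XX: "E - (E - X) = X" using assms(4) by auto
  note rE = rank_ground[OF m]
  consider (many) "s - 1 \<le> ?a" | (dual) "?a < s - 1" "t - 1 \<le> ?b"
    | (mid) "?a < s - 1" "s - 1 \<le> ?b" "?b < t - 1" | (few) "?a < s - 1" "?b < s - 1"
    by linarith
  then show ?thesis
  proof cases
    case many
    have ab: "?a \<le> card (meeting X)" "?b \<le> card (meeting (E - X))"
      using finite_subset[OF meeting_subset] inside_subset_meeting by (intro card_mono; auto)+
    have eqs: "card (meeting X) + ?b = m" "card (meeting (E - X)) + ?a = m"
      using card_meeting[of X] card_meeting[of "E - X"] XX by auto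
    have b: "s - 1 \<le> ?b" using many le by linarith
    have "rank X = rank E \<or> s - 1 + m \<le> rank X + ?b"
      using rank_ge_many_inside[OF m assms(4) many] .
    moreover have "rank (E - X) = rank E \<or> s - 1 + m \<le> rank (E - X) + ?a"
      using rank_ge_many_inside[OF m Y b] XX by simp
    \<comment> \<open>If both sides are spanning, the value is \<open>rank E\<close>. If exactly one
      is, it is at least \<open>s - 1\<close> plus the number of arms inside the spanning side. If
      neither is, it is at least \<open>s + t - 2\<close>, as at most \<open>m\<close> arms lie
      inside the two sides.\<close>
    ultimately show ?thesis
      using rE ab eqs assms(1-3) many b unfolding connectivity_def by (elim disjE; linarith)
  next
    case dual
    interpret dual: st_spike E dual_indep t s m A by (rule dual_spike)
    have "rank (E - X) = rank E"
      using dual assms(2) XX by (intro rank_eq_ground Y) auto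
    \<comment> \<open>\<open>E - X\<close> is spanning in the matroid and in its dual. The first
      gives connectivity \<open>rank X\<close>, and by the corank formula the second gives
      \<open>rank X = card X\<close>.\<close>
    moreover have "dual_rank (E - X) = dual_rank E"
      using dual XX by (intro dual.rank_eq_ground Y) auto
    ultimately show ?thesis
      using card_compl[OF assms(4)] dual_rank_eq[OF Y] dual_rank_eq[of E] XX rank_indep[OF indep_empty]
      unfolding connectivity_def by simp
  next
    case mid
    have "rank (E - X) = rank E"
      using mid assms(2) XX by (intro rank_eq_ground Y) auto
    moreover have "m + 1 + ?a \<le> rank X + t"
      using mid by (intro rank_ge_few_inside m assms(4)) auto
    ultimately show ?thesis using assms unfolding connectivity_def by linarith
  next
    case few
    have "m + 1 + ?a \<le> rank X + t"
      using few assms(2) by (intro rank_ge_few_inside m assms(4)) auto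
    moreover have "m + 1 + ?b \<le> rank (E - X) + t"
      using few assms(2) XX by (intro rank_ge_few_inside m Y) auto
    \<comment> \<open>The sum of the two bounds minus \<open>rank E\<close> is at least
      \<open>m + 2 - s - t\<close>, and \<open>m \<ge> s + 3 * t - 4\<close> turns this into exactly
      \<open>2 * t - 2\<close>.\<close>
    ultimately show ?thesis using rE assms unfolding connectivity_def by linarith
  qed
qed

lemma connectivity_ge_le:
  assumes "2 \<le> s" "s \<le> t" "s + 3 * t \<le> m + 4" "X \<subseteq> E"
  shows "min (2 * int s - 2) (int (min (card X) (card (E - X)))) \<le> connectivity X"
proof (cases "card (inside X) \<le> card (inside (E - X))")
  case True
  then show ?thesis using connectivity_ge_ordered[OF assms] by simp
next
  case False
  then show ?thesis
    using connectivity_ge_ordered[OF assms(1-3), of "E - X"] connectivity_compl[OF assms(4)]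
    by (simp add: double_diff assms(4))
qed

lemma connectivity_ge:
  assumes "2 \<le> min s t" "max (3 * s + t) (s + 3 * t) \<le> m + 4" "X \<subseteq> E"
  shows "min (2 * int (min s t) - 2) (int (min (card X) (card (E - X)))) \<le> connectivity X"
proof (cases "s \<le> t")
  case True
  then show ?thesis using connectivity_ge_le[of X] assms by (simp add: min_absorb1)
next
  case False
  interpret dual: st_spike E dual_indep t s m A by (rule dual_spike)
  show ?thesis
    using dual.connectivity_ge_le[of X] connectivity_dual[OF assms(3)] assms False
    by (simp add: min_absorb2)
qed

end

theorem theorem5p8:
  fixes E :: "'a set" and indep :: "'a set \<Rightarrow> bool"
    and s t m :: nat and A :: "nat \<Rightarrow> 'a set"
  assumes "min s t \<ge> 2"
    and "st_spike E indep s t m A"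
    and "m \<ge> max (3 * s + t) (s + 3 * t) - 4"
  shows "matroid.n_connected E indep (2 * min s t - 1)"
proof -
  interpret st_spike E indep s t m A by (rule assms(2))
  show ?thesis unfolding n_connected_def
  proof (intro allI impI notI)
    fix k assume k: "k < 2 * min s t - 1" and "\<exists>X Y. k_separation k X Y"
    then obtain X Y where XY: "k_separation k X Y" by blast
    then have sub: "X \<subseteq> E" and "Y = E - X" unfolding k_separation_def by auto
    \<comment> \<open>Both sides of a \<open>k\<close>-separation have at least \<open>k\<close>
      elements, so \<open>k\<close> is below each term of the minimum and the connectivity cannot be
      smaller than \<open>k\<close>.\<close>
    then have "int k \<le> min (2 * int (min s t) - 2) (int (min (card X) (card (E - X))))"
      using XY k unfolding k_separation_def by auto
    also have "\<dots> \<le> connectivity X"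
      using assms by (intro connectivity_ge sub) auto
    finally show False using XY unfolding k_separation_def by simp
  qed
qed

end
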